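(* Let $\kappa$ be a positive integer, finite or infinite, and let $A$ be a nonempty subset of $[1..\kappa]$. Then $A$ is measured.
   Context: We work in Sergeyev's numeral system, which contains the standard numerals for finite integers together with the symbol ① (grossone), defined as the number of elements of the set of natural numbers, with $n<$ ① for every finite positive integer $n$; positive integers may be finite or infinite, possibly larger than ①. For a number $\mu$, $[1..\mu]$ denotes the set of integers $k$ with $1\le k\le\mu$. A measurement of a nonempty set $E$ is a (described) bijection from $[1..\mu]$ onto $E$ for some positive integer $\mu$ expressible in the numeral system; $E$ is then measured. Axiom: every initial segment $S$ of $[1..\kappa]$ (i.e. $1\in S$ and $S$ downward closed) equals $[1..\sigma]$ for some $\sigma\le\kappa$.
   Formalization: Sets and bijections are described ones, closed under definability, as the axiom fails for the set of all finite positive integers in [1..①]; the σ of the axiom is taken to be expressible, as A = [1..κ] requires. *)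

theory Defs
  imports Main
begin

text \<open>
  The integers of the numeral system, finite and infinite, are the elements of an ordered
  commutative ring (assumed discrete below); the finite ones are the images of the integers
  under \<open>of_int\<close>.  A closed interval \<open>[1..\<mu>]\<close> is the library interval \<open>{1..\<mu>}\<close>.

  The initial-segment axiom cannot hold for arbitrary collections in the sense of HOL: the
  collection of all finite positive integers is a downward closed part of \<open>[1..gross]\<close> without a
  last element.  The sets and correspondences of the theory are the described ones, so a numeral
  system comes with the family of described sets of integers and the family of described
  binary relations between integers.
\<close>

record 'a numeral_system =
  gross :: 'a
  expressible :: "'a set"
  described_sets :: "'a set set"
  described_rels :: "('a \<times> 'a) set set"

text \<open>
  Descriptions are formulas over the arithmetic of the numeral system.  Described objects may occur
  in them both as parameters and as values of bound variables (last two quantifiers).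
  Variables of the three sorts are indexed by natural numbers independently of each other.
\<close>

datatype num_term =
  Var nat
| Zero
| One
| Gross
| Minus num_term
| Plus num_term num_term
| Times num_term num_term

datatype description =
  Equal num_term num_term
| Less num_term num_term
| InSet num_term nat
| InRel num_term num_term nat
| Neg description
| Conj description description
| ExNum nat description
| ExSet nat description
| ExRel nat description

primrec val :: "('a::linordered_idom) numeral_system \<Rightarrow> (nat \<Rightarrow> 'a) \<Rightarrow> num_term \<Rightarrow> 'a" where
  "val G v (Var i) = v i"
| "val G v Zero = 0"
| "val G v One = 1"
| "val G v Gross = gross G"
| "val G v (Minus s) = - val G v s"
| "val G v (Plus s t) = val G v s + val G v t"
| "val G v (Times s t) = val G v s * val G v t"

primrec holds :: "('a::linordered_idom) numeral_system \<Rightarrow> (nat \<Rightarrow> 'a) \<Rightarrow> (nat \<Rightarrow> 'a set) \<Rightarrow>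
    (nat \<Rightarrow> ('a \<times> 'a) set) \<Rightarrow> description \<Rightarrow> bool" where
  "holds G v X R (Equal s t) \<longleftrightarrow> val G v s = val G v t"
| "holds G v X R (Less s t) \<longleftrightarrow> val G v s < val G v t"
| "holds G v X R (InSet t i) \<longleftrightarrow> val G v t \<in> X i"
| "holds G v X R (InRel s t i) \<longleftrightarrow> (val G v s, val G v t) \<in> R i"
| "holds G v X R (Neg p) \<longleftrightarrow> \<not> holds G v X R p"
| "holds G v X R (Conj p q) \<longleftrightarrow> holds G v X R p \<and> holds G v X R q"
| "holds G v X R (ExNum i p) \<longleftrightarrow> (\<exists>x. holds G (v(i := x)) X R p)"
| "holds G v X R (ExSet i p) \<longleftrightarrow> (\<exists>S \<in> described_sets G. holds G v (X(i := S)) R p)"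
| "holds G v X R (ExRel i p) \<longleftrightarrow> (\<exists>Q \<in> described_rels G. holds G v X (R(i := Q)) p)"

definition initial_segment :: "('a::linordered_idom) \<Rightarrow> 'a set \<Rightarrow> bool" where
  "initial_segment \<kappa> S \<longleftrightarrow>
     S \<subseteq> {1..\<kappa>} \<and> 1 \<in> S \<and> (\<forall>k\<in>S. \<forall>j. 1 \<le> j \<and> j \<le> k \<longrightarrow> j \<in> S)"

text \<open>
  Numbers occurring in the theory are numbers of the numeral system; this is why the \<open>\<sigma>\<close> supplied
  by the initial-segment axiom is expressible.  Applied to \<open>[1..k]\<close>, the axiom makes every positive
  integer \<open>k\<close> expressible.  The comprehension axioms say that whatever a description (with
  described parameters) singles out is a described set or relation.
\<close>

locale grossone =
  fixes G :: "('a::linordered_idom) numeral_system"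
  assumes discrete: "0 < (x::'a) \<Longrightarrow> 1 \<le> x"
    and finite_less_gross: "of_nat n < gross G"
    and finite_expressible: "of_int z \<in> expressible G"
    and gross_expressible: "gross G \<in> expressible G"
    and empty_set_described: "{} \<in> described_sets G"
    and empty_rel_described: "{} \<in> described_rels G"
    and set_comprehension:
      "range X \<subseteq> described_sets G \<Longrightarrow> range R \<subseteq> described_rels G \<Longrightarrow>
       {x. holds G (v(0 := x)) X R p} \<in> described_sets G"
    and rel_comprehension:
      "range X \<subseteq> described_sets G \<Longrightarrow> range R \<subseteq> described_rels G \<Longrightarrow>
       {(x, y). holds G (v(0 := x, 1 := y)) X R p} \<in> described_rels G"
    and initial_segment_axiom:
      "1 \<le> \<kappa> \<Longrightarrow> S \<in> described_sets G \<Longrightarrow> initial_segment \<kappa> S \<Longrightarrow>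
       \<exists>\<sigma> \<in> expressible G. \<sigma> \<le> \<kappa> \<and> S = {1..\<sigma>}"

definition described_on ::
    "('a::linordered_idom) numeral_system \<Rightarrow> ('a \<Rightarrow> 'a) \<Rightarrow> 'a set \<Rightarrow> bool" where
  "described_on G f D \<longleftrightarrow> {(k, f k) | k. k \<in> D} \<in> described_rels G"

definition measurement ::
    "('a::linordered_idom) numeral_system \<Rightarrow> 'a \<Rightarrow> ('a \<Rightarrow> 'a) \<Rightarrow> 'a set \<Rightarrow> bool" where
  "measurement G \<mu> f E \<longleftrightarrow>
     E \<noteq> {} \<and> 1 \<le> \<mu> \<and> \<mu> \<in> expressible G \<and> bij_betw f {1..\<mu>} E \<and> described_on G f {1..\<mu>}"

definition measured :: "('a::linordered_idom) numeral_system \<Rightarrow> 'a set \<Rightarrow> bool" where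
  "measured G E \<longleftrightarrow> (\<exists>\<mu> f. measurement G \<mu> f E)"

text \<open>
  The natural numbers of the theory reach up to \<open>gross\<close>, which is therefore their number.
\<close>

definition naturals :: "('a::linordered_idom) numeral_system \<Rightarrow> 'a set" where
  "naturals G = {1..gross G}"

lemma (in grossone) measurement_naturals: "measurement G (gross G) id (naturals G)"
proof -
  let ?p = "Conj (Equal (Var 0) (Var 1)) (Conj (Neg (Less (Var 0) One)) (Neg (Less Gross (Var 0))))"
  have "{(x, y). holds G ((\<lambda>_. 0)(0 := x, 1 := y)) (\<lambda>_. {}) (\<lambda>_. {}) ?p} \<in> described_rels G"
    by (rule rel_comprehension) (auto simp: empty_set_described empty_rel_described)
  also have "{(x, y). holds G ((\<lambda>_. 0)(0 := x, 1 := y)) (\<lambda>_. {}) (\<lambda>_. {}) ?p}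
      = {(k, id k) | k. k \<in> {1..gross G}}"
    by auto
  finally show ?thesis
    using finite_less_gross[of 1] gross_expressible
    by (auto simp: measurement_def described_on_def naturals_def)
qed

end

theory Submission
  imports Defs
begin

text \<open>
  Comprehension turns the initial-segment axiom into induction along \<open>[1..\<kappa>]\<close> for described
  properties.  That \<open>A \<inter> [1..k)\<close> is enumerated by \<open>[1..\<mu>]\<close> for some \<open>\<mu> \<ge> 0\<close> through a described
  relation is such a property of \<open>k\<close>: passing from \<open>k\<close> to \<open>k + 1\<close> extends the relation by at most
  one pair.
\<close>

definition All_num :: "nat \<Rightarrow> description \<Rightarrow> description" where
  "All_num i p = Neg (ExNum i (Neg p))"

definition Implies :: "description \<Rightarrow> description \<Rightarrow> description" where
  "Implies p q = Neg (Conj p (Neg q))"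

definition Leq :: "num_term \<Rightarrow> num_term \<Rightarrow> description" where
  "Leq s t = Neg (Less t s)"

lemma holds_derived [simp]:
  "holds G v X R (All_num i p) \<longleftrightarrow> (\<forall>x. holds G (v(i := x)) X R p)"
  "holds G v X R (Implies p q) \<longleftrightarrow> (holds G v X R p \<longrightarrow> holds G v X R q)"
  "holds G v X R (Leq s t) \<longleftrightarrow> val G v s \<le> val G v t"
  by (auto simp: All_num_def Implies_def Leq_def not_less)

text \<open>The bijection is encoded by its graph \<open>Q\<close>, because a
  \<open>description\<close> can bind relations but not functions; the clauses quantify over numbers
  only. The value \<mu> = 0 serves the empty \<open>E\<close>. The last clause is single-valuedness
  and injectivity at once.\<close>

definition enumerates ::
    "('a::linordered_idom \<times> 'a) set \<Rightarrow> 'a \<Rightarrow> 'a set \<Rightarrow> bool" where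
  "enumerates Q \<mu> E \<longleftrightarrow>
     (\<forall>x y. (x, y) \<in> Q \<longrightarrow> 1 \<le> x \<and> x \<le> \<mu> \<and> y \<in> E) \<and>
     (\<forall>x. 1 \<le> x \<and> x \<le> \<mu> \<longrightarrow> (\<exists>y. (x, y) \<in> Q)) \<and>
     (\<forall>y. y \<in> E \<longrightarrow> (\<exists>x. (x, y) \<in> Q)) \<and>
     (\<forall>x y x' y'. (x, y) \<in> Q \<and> (x', y') \<in> Q \<longrightarrow> (x = x' \<longleftrightarrow> y = y'))"

lemma enumerates_empty: "enumerates {} 0 {}"
  by (auto simp: enumerates_def)

text \<open>The graph of \<open>f\<close> is \<open>Q\<close> itself, so describedness of
  \<open>Q\<close> is exactly what \<open>described_on\<close> asks of \<open>f\<close>.\<close>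

lemma enumerates_bij_betw:
  assumes "enumerates Q \<mu> E"
  obtains f where "bij_betw f {1..\<mu>} E" "Q = {(k, f k) | k. k \<in> {1..\<mu>}}"
proof -
  \<comment> \<open>\<open>f\<close> is merely chosen in HOL; single-valuedness of \<open>Q\<close>
    then forces its graph over [1..\<mu>] to be \<open>Q\<close>.\<close>
  from assms have "\<forall>x\<in>{1..\<mu>}. \<exists>y. (x, y) \<in> Q"
    by (auto simp: enumerates_def)
  then obtain f where f: "\<And>x. x \<in> {1..\<mu>} \<Longrightarrow> (x, f x) \<in> Q"
    by metis
  have Q: "x \<in> {1..\<mu>} \<and> y \<in> E \<and> y = f x" if "(x, y) \<in> Q" for x y
  proof -
    have "x \<in> {1..\<mu>}" "y \<in> E"
      using assms that unfolding enumerates_def by auto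
    moreover have "y = f x"
      using assms that f[OF \<open>x \<in> {1..\<mu>}\<close>] unfolding enumerates_def by blast
    ultimately show ?thesis by blast
  qed
  have inj: "x = x'" if "(x, y) \<in> Q" "(x', y) \<in> Q" for x x' y
    using assms that unfolding enumerates_def by blast
  have onto: "\<exists>x. (x, y) \<in> Q" if "y \<in> E" for y
    using assms that unfolding enumerates_def by blast
  show thesis
  proof
    show "bij_betw f {1..\<mu>} E"
      unfolding bij_betw_def
    proof
      show "inj_on f {1..\<mu>}"
        by (metis f inj inj_onI)
      show "f ` {1..\<mu>} = E"
        using f Q onto by blast
    qed
    show "Q = {(k, f k) | k. k \<in> {1..\<mu>}}"
      using f Q by fastforce
  qed
qed

context grossone
begin

text \<open>Discreteness, applied to the difference, leaves no number strictly between
  \<open>x\<close> and \<open>x + 1\<close>.\<close>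

lemma less_iff_add_one_le: "x < y \<longleftrightarrow> x + 1 \<le> (y::'a)"
proof
  assume "x < y"
  then have "1 \<le> y - x" by (intro discrete) simp
  then show "x + 1 \<le> y" by (simp only: le_diff_eq add.commute)
next
  assume "x + 1 \<le> y"
  then show "x < y" by (rule less_le_trans[OF less_add_one])
qed

text \<open>The new index \<mu> + 1 is at least 1 because 0 \<le> \<mu>, and by discreteness it is
  the only index added. Neither it nor the value \<open>a\<close> occurs in \<open>Q\<close>, so the
  correspondence stays one-to-one.\<close>

lemma enumerates_insert:
  assumes "enumerates Q \<mu> E" "0 \<le> \<mu>" "a \<notin> E"
  shows "enumerates (insert (\<mu> + 1, a) Q) (\<mu> + 1) (insert (a::'a) E)"
proof -
  have le: "x \<le> \<mu> + 1 \<longleftrightarrow> x \<le> \<mu> \<or> x = \<mu> + 1" for x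
    using less_iff_add_one_le[of \<mu> x] by auto
  have Q: "1 \<le> x \<and> x \<le> \<mu> \<and> y \<in> E" if "(x, y) \<in> Q" for x y
    using assms(1) that unfolding enumerates_def by blast
  have new: "(\<mu> + 1, y) \<notin> Q" "(x, a) \<notin> Q" for x y
    using Q[of "\<mu> + 1" y] Q[of x a] assms(3) by auto
  have onto: "\<exists>y. (x, y) \<in> Q" if "1 \<le> x" "x \<le> \<mu>" for x
    using assms(1) that unfolding enumerates_def by blast
  have into: "\<exists>x. (x, y) \<in> Q" if "y \<in> E" for y
    using assms(1) that unfolding enumerates_def by blast
  have uniq: "x = x' \<longleftrightarrow> y = y'" if "(x, y) \<in> Q" "(x', y') \<in> Q" for x y x' y'
    using assms(1) that unfolding enumerates_def by blast
  show ?thesis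
    unfolding enumerates_def le
  proof (intro conjI allI impI, goal_cases)
    case (4 x)
    then show ?case using onto[of x] by blast
  next
    case (5 y)
    then show ?case using into[of y] by blast
  next
    case (6 x y x' y')
    then show ?case using new uniq[of x y x' y'] by auto
  qed (use Q assms(2) in auto)
qed

lemma described_atLeastAtMost: "{a..b} \<in> described_sets G"
proof -
  \<comment> \<open>Comprehension reserves number variable 0 for the element, so the parameters
    occupy variables 1 and 2.\<close>
  let ?v = "(\<lambda>_. 0)(1 := a, 2 := b)"
  let ?p = "Conj (Leq (Var 1) (Var 0)) (Leq (Var 0) (Var 2))"
  have "{x. holds G (?v(0 := x)) (\<lambda>_. {}) (\<lambda>_. {}) ?p} \<in> described_sets G"
    by (rule set_comprehension) (auto simp: empty_set_described empty_rel_described)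
  also have "{x. holds G (?v(0 := x)) (\<lambda>_. {}) (\<lambda>_. {}) ?p} = {a..b}"
    by auto
  finally show ?thesis .
qed

lemma described_insert_rel:
  assumes "Q \<in> described_rels G"
  shows "insert (a, b) Q \<in> described_rels G"
proof -
  let ?v = "(\<lambda>_. 0)(2 := a, 3 := b)"
  \<comment> \<open>A disjunction written as an implication: the pair lies in \<open>Q\<close> or
    else is (a, b).\<close>
  let ?p = "Implies (Neg (InRel (Var 0) (Var 1) 0))
    (Conj (Equal (Var 0) (Var 2)) (Equal (Var 1) (Var 3)))"
  have "{(x, y). holds G (?v(0 := x, 1 := y)) (\<lambda>_. {}) (\<lambda>_. Q) ?p} \<in> described_rels G"
    by (rule rel_comprehension) (auto simp: empty_set_described assms)
  also have "{(x, y). holds G (?v(0 := x, 1 := y)) (\<lambda>_. {}) (\<lambda>_. Q) ?p} = insert (a, b) Q"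
    by auto
  finally show ?thesis .
qed

text \<open>The axiom, applied to [1..\<mu>], returns an expressible right endpoint, and a nonempty
  interval determines its endpoints.\<close>

lemma expressible_pos:
  assumes "1 \<le> \<mu>"
  shows "\<mu> \<in> expressible G"
proof -
  have "initial_segment \<mu> {1..\<mu>}"
    using assms by (auto simp: initial_segment_def)
  then obtain \<sigma> where "\<sigma> \<in> expressible G" "{1..\<mu>} = {1..\<sigma>}"
    using initial_segment_axiom[OF assms described_atLeastAtMost] by blast
  with assms show ?thesis
    by (simp add: Icc_eq_Icc)
qed

text \<open>The axiom supplies the last number \<sigma> up to which \<open>S\<close> has no gap; if
  \<sigma> < \<kappa>, the step would carry \<open>S\<close> on to \<sigma> + 1.\<close>

lemma described_induct:
  assumes S: "S \<in> described_sets G"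
    and one: "1 \<in> S"
    and step: "\<And>k. 1 \<le> k \<Longrightarrow> k < \<kappa> \<Longrightarrow> k \<in> S \<Longrightarrow> k + 1 \<in> S"
    and \<kappa>: "1 \<le> \<kappa>"
  shows "\<kappa> \<in> S"
proof -
  \<comment> \<open>\<open>S\<close> need not be downward closed, whereas \<open>?T\<close> is so by
    construction and is described with parameters \<open>S\<close> and \<kappa>.\<close>
  let ?T = "{k. 1 \<le> k \<and> k \<le> \<kappa> \<and> (\<forall>j. 1 \<le> j \<and> j \<le> k \<longrightarrow> j \<in> S)}"
  let ?v = "(\<lambda>_. 0)(1 := \<kappa>)"
  let ?p = "Conj (Leq One (Var 0)) (Conj (Leq (Var 0) (Var 1))
    (All_num 2 (Implies (Conj (Leq One (Var 2)) (Leq (Var 2) (Var 0))) (InSet (Var 2) 0))))"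
  have "{x. holds G (?v(0 := x)) (\<lambda>_. S) (\<lambda>_. {}) ?p} \<in> described_sets G"
    by (rule set_comprehension) (auto simp: S empty_rel_described)
  also have "{x. holds G (?v(0 := x)) (\<lambda>_. S) (\<lambda>_. {}) ?p} = ?T"
    by simp
  finally have "?T \<in> described_sets G" .
  moreover have "initial_segment \<kappa> ?T"
    using one \<kappa> by (auto simp: initial_segment_def)
  ultimately obtain \<sigma> where \<sigma>: "\<sigma> \<le> \<kappa>" "?T = {1..\<sigma>}"
    using initial_segment_axiom[OF \<kappa>] by blast
  have "1 \<in> ?T"
    using one \<kappa> by auto
  then have "1 \<le> \<sigma>"
    unfolding \<sigma>(2) by simp
  then have "\<sigma> \<in> ?T"
    unfolding \<sigma>(2) by simp
  then have below: "j \<in> S" if "1 \<le> j" "j \<le> \<sigma>" for j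
    using that by blast
  have "\<sigma> = \<kappa>"
  proof (rule ccontr)
    assume "\<sigma> \<noteq> \<kappa>"
    with \<sigma>(1) have "\<sigma> < \<kappa>" by simp
    then have "\<sigma> + 1 \<in> S" "\<sigma> + 1 \<le> \<kappa>"
      using step below \<open>1 \<le> \<sigma>\<close> by (auto simp: less_iff_add_one_le)
    moreover have "j \<le> \<sigma> \<or> j = \<sigma> + 1" if "j \<le> \<sigma> + 1" for j
      using that less_iff_add_one_le[of \<sigma> j] by auto
    ultimately have "\<sigma> + 1 \<in> ?T"
      using below \<open>1 \<le> \<sigma>\<close> by auto
    then show False
      unfolding \<sigma>(2) by simp
  qed
  then show ?thesis
    using below \<kappa> by simp
qed

text \<open>Induction needs a described property, and this one quantifies over correspondences; the
  quantifier \<open>ExRel\<close> makes it expressible.\<close>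

lemma described_enumerable:
  assumes "A \<in> described_sets G"
  shows "{k. \<exists>\<mu>. 0 \<le> \<mu> \<and> (\<exists>Q\<in>described_rels G. enumerates Q \<mu> {y \<in> A. y < k})}
    \<in> described_sets G"
proof -
  \<comment> \<open>Number variable 0 is \<open>k\<close>, 1 is \<mu>, and 2 to 5 are indices and
    values; set variable 0 is \<open>A\<close>, and relation variable 0 is \<open>Q\<close>.\<close>
  let ?in = "\<lambda>t. Conj (InSet t 0) (Less t (Var 0))"
  let ?p = "ExNum 1 (Conj (Leq Zero (Var 1)) (ExRel 0
    (Conj (All_num 2 (All_num 3 (Implies (InRel (Var 2) (Var 3) 0)
        (Conj (Leq One (Var 2)) (Conj (Leq (Var 2) (Var 1)) (?in (Var 3)))))))
    (Conj (All_num 2 (Implies (Conj (Leq One (Var 2)) (Leq (Var 2) (Var 1)))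
        (ExNum 3 (InRel (Var 2) (Var 3) 0))))
    (Conj (All_num 3 (Implies (?in (Var 3)) (ExNum 2 (InRel (Var 2) (Var 3) 0))))
      (All_num 2 (All_num 3 (All_num 4 (All_num 5
        (Implies (Conj (InRel (Var 2) (Var 3) 0) (InRel (Var 4) (Var 5) 0))
          (Conj (Implies (Equal (Var 2) (Var 4)) (Equal (Var 3) (Var 5)))
            (Implies (Equal (Var 3) (Var 5)) (Equal (Var 2) (Var 4))))))))))))))"
  have "{x. holds G ((\<lambda>_. 0)(0 := x)) (\<lambda>_. A) (\<lambda>_. {}) ?p} \<in> described_sets G"
    by (rule set_comprehension) (auto simp: assms empty_rel_described)
  then show ?thesis
    \<comment> \<open>In \<open>?p\<close> the equivalence of the last clause is a pair of
      implications.\<close>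
    unfolding enumerates_def by (simp add: iff_conv_conj_imp)
qed

lemma measured_of_enumerates:
  assumes "enumerates Q \<mu> E" "Q \<in> described_rels G" "E \<noteq> {}"
  shows "measured G E"
proof -
  obtain f where f: "bij_betw f {1..\<mu>} E" "Q = {(k, f k) | k. k \<in> {1..\<mu>}}"
    using enumerates_bij_betw[OF assms(1)] .
  \<comment> \<open>If \<mu> < 1, the interval, and with it \<open>E\<close>, would be
    empty.\<close>
  from f(1) assms(3) have "1 \<le> \<mu>"
    by (auto simp: bij_betw_def)
  with f(1) assms(2,3) have "measurement G \<mu> f E"
    unfolding measurement_def described_on_def
    by (simp add: f(2) expressible_pos)
  then show ?thesis
    unfolding measured_def by blast
qed

lemma bounded_described_measured:
  assumes A: "A \<in> described_sets G" "A \<noteq> {}" "A \<subseteq> {1..\<kappa>}"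
    and \<kappa>: "1 \<le> \<kappa>"
  shows "measured G A"
proof -
  let ?S = "{k. \<exists>\<mu>. 0 \<le> \<mu> \<and> (\<exists>Q\<in>described_rels G. enumerates Q \<mu> {y \<in> A. y < k})}"
  \<comment> \<open>As the bound y < k is strict, the induction starts from the empty set at k = 1
    and reaches all of \<open>A\<close> only at \<kappa> + 1.\<close>
  have "\<kappa> + 1 \<in> ?S"
  proof (rule described_induct[OF described_enumerable[OF A(1)]])
    have "{y \<in> A. y < 1} = {}"
      using A(3) by force
    then have "enumerates {} 0 {y \<in> A. y < 1}"
      using enumerates_empty by (simp only:)
    then show "1 \<in> ?S"
      using empty_rel_described by (intro CollectI exI[of _ 0] conjI bexI[of _ "{}"]) simp_all
  next
    fix k
    assume "k \<in> ?S"
    then obtain \<mu> Q where Q: "0 \<le> \<mu>" "Q \<in> described_rels G" "enumerates Q \<mu> {y \<in> A. y < k}"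
      by blast
    have lt: "y < k + 1 \<longleftrightarrow> y < k \<or> y = k" for y
      using less_iff_add_one_le[of y "k + 1"] by auto
    show "k + 1 \<in> ?S"
    proof (cases "k \<in> A")
      case True
      \<comment> \<open>\<open>k\<close> exceeds every element counted so far and receives the next
        index \<mu> + 1.\<close>
      then have "{y \<in> A. y < k + 1} = insert k {y \<in> A. y < k}"
        unfolding lt by auto
      then have "enumerates (insert (\<mu> + 1, k) Q) (\<mu> + 1) {y \<in> A. y < k + 1}"
        using enumerates_insert[OF Q(3,1), of k] by simp
      with Q(1,2) show ?thesis
        by (intro CollectI exI[of _ "\<mu> + 1"] conjI bexI[of _ "insert (\<mu> + 1, k) Q"])
          (simp_all add: described_insert_rel)
    next
      case False
      then have "{y \<in> A. y < k + 1} = {y \<in> A. y < k}"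
        unfolding lt by auto
      with Q show ?thesis
        by (intro CollectI exI[of _ \<mu>] conjI bexI[of _ Q]) simp_all
    qed
  qed (use \<kappa> in simp)
  moreover have "{y \<in> A. y < \<kappa> + 1} = A"
    using A(3) by (auto simp: less_iff_add_one_le)
  ultimately obtain \<mu> Q where "Q \<in> described_rels G" "enumerates Q \<mu> A"
    by (simp only: mem_Collect_eq) blast
  then show ?thesis
    using measured_of_enumerates A(2) by blast
qed

end

theorem theorem8:
  fixes G :: "('a::linordered_idom) numeral_system"
    and \<kappa> :: 'a
    and A :: "'a set"
  assumes "grossone G"
    and "1 \<le> \<kappa>"
    and "A \<in> described_sets G"
    and "A \<noteq> {}"
    and "A \<subseteq> {1..\<kappa>}"
  shows "measured G A"
  using grossone.bounded_described_measured assms by blast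

end
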